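(* Let $n\ge 1$ be an integer, $x\ge 1$ a real number, and $k,l\ge 1$ integers. Then $$f_k(n,l)=\sum_{\substack{0\le i\le k\\ l^i\mid n}}\binom{k}{i}\,f_{k-i}\!\left(\frac{n}{l^i},\,l+1\right),\qquad F_k(x,l)=\sum_{i=0}^{k}\binom{k}{i}\,F_{k-i}\!\left(\frac{x}{l^i},\,l+1\right).$$ Further, if $k\ge 2$, then $$f_k(n,l)=\sum_{m=l}^{\lfloor \sqrt[k]{n}\rfloor}\ \sum_{\substack{1\le i\le k\\ m^i\mid n}}\binom{k}{i}\,f_{k-i}\!\left(\frac{n}{m^i},\,m+1\right),\qquad F_k(x,l)=\sum_{m=l}^{\lfloor \sqrt[k]{x}\rfloor}\ \sum_{i=1}^{k}\binom{k}{i}\,F_{k-i}\!\left(\frac{x}{m^i},\,m+1\right).$$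
   Context: For integers $n\ge1$, $k\ge 1$, $l\ge 1$, $f_k(n,l)=\#\{(i_1,\dots,i_k)\in\mathbb{Z}^k : i_1,\dots,i_k\ge l,\ i_1\cdots i_k=n\}$ is the number of ordered factorizations of $n$ into exactly $k$ factors, each at least $l$ (different orders count as different). For $k=0$: $f_0(1,l)=1$ and $f_0(n,l)=0$ for $n\ge 2$. For real $y>0$ and integers $k\ge 0$, $l\ge 1$, $F_k(y,l)=\sum_{1\le n\le y} f_k(n,l)$. Empty sums are zero; in particular $F_k(y,l)=0$ for $0<y<1$ (including $k=0$), while $F_0(y,l)=1$ for $y\ge 1$. *)

theory Defs
  imports Complex_Main
begin

text \<open>
  A \<open>k\<close>-tuple of integers is an integer list of length \<open>k\<close>.  For \<open>k = 0\<close> the only tuple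
  is the empty list, whose product is \<open>1\<close>, which gives the usual values of \<open>f\<^sub>0\<close> (lemma
  \<open>ordered_fact_0\<close>).  For \<open>l \<ge> 1\<close> and \<open>n \<ge> 1\<close> the set counted is finite.
\<close>

definition ordered_fact :: "nat \<Rightarrow> nat \<Rightarrow> nat \<Rightarrow> nat" where
  "ordered_fact k n l =
     card {is :: int list. length is = k \<and> (\<forall>i \<in> set is. i \<ge> int l) \<and> prod_list is = int n}"

definition ordered_fact_sum :: "nat \<Rightarrow> real \<Rightarrow> nat \<Rightarrow> nat" where
  "ordered_fact_sum k y l = (\<Sum>n | 1 \<le> n \<and> real n \<le> y. ordered_fact k n l)"

lemma ordered_fact_0: "ordered_fact 0 n l = (if n = 1 then 1 else 0)"
proof -
  have "{is :: int list. length is = 0 \<and> (\<forall>i \<in> set is. i \<ge> int l) \<and> prod_list is = int n}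
      = (if n = 1 then {[]} else {})"
    by auto
  then show ?thesis by (simp add: ordered_fact_def)
qed

lemma ordered_fact_sum_less_1: "y < 1 \<Longrightarrow> ordered_fact_sum k y l = 0"
  unfolding ordered_fact_sum_def by (rule sum.neutral) auto

lemma ordered_fact_sum_0: "y \<ge> 1 \<Longrightarrow> ordered_fact_sum 0 y l = 1"
proof -
  assume "y \<ge> 1"
  have fin: "finite {n::nat. 1 \<le> n \<and> real n \<le> y}"
    by (rule finite_subset[of _ "{..nat \<lfloor>y\<rfloor>}"]) (auto simp: le_nat_floor)
  show ?thesis
    unfolding ordered_fact_sum_def ordered_fact_0
    using fin \<open>y \<ge> 1\<close> by (simp add: sum.delta)
qed

end

theory Submission
  imports Defs
begin

text \<open>
  Sort the factorizations of \<open>n\<close> into \<open>k\<close> factors \<open>\<ge> l\<close> by the number \<open>i\<close> of factors equal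
  to \<open>l\<close>.  Such a factorization is an interleaving of \<open>i\<close> copies of \<open>l\<close> with a factorization
  of \<open>n / l\<^sup>i\<close> into \<open>k - i\<close> factors \<open>\<ge> l + 1\<close>, and conversely; there are \<open>k choose i\<close>
  interleavings for each of the latter (\<open>card_factorizations_count\<close>).  Summing over \<open>i\<close>
  gives the first identity (\<open>ordered_fact_step\<close>).

  Summing that identity over \<open>n \<le> x\<close> and substituting \<open>n = l\<^sup>i m\<close> gives the identity for the
  summatory function (\<open>ordered_fact_sum_step\<close>).

  In both identities the term \<open>i = 0\<close> is the left-hand side with \<open>l\<close> replaced by \<open>l + 1\<close>.
  Iterating them in \<open>l\<close> therefore telescopes (\<open>telescope_vanishing\<close>), and the process ends
  because \<open>k\<close> factors greater than the \<open>k\<close>-th root of \<open>n\<close> have a product greater than \<open>n\<close>.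
\<close>

section \<open>Factorizations with a given number of minimal factors\<close>

text \<open>The set counted by \<^const>\<open>ordered_fact\<close>.\<close>

definition factorizations :: "nat \<Rightarrow> nat \<Rightarrow> nat \<Rightarrow> int list set" where
  "factorizations k n l =
     {xs. length xs = k \<and> (\<forall>i \<in> set xs. i \<ge> int l) \<and> prod_list xs = int n}"

lemma ordered_fact_eq_card: "ordered_fact k n l = card (factorizations k n l)"
  by (simp add: ordered_fact_def factorizations_def)

lemma finite_factorizations:
  assumes "n \<ge> 1" "l \<ge> 1"
  shows "finite (factorizations k n l)"
proof (rule finite_subset)
  show "factorizations k n l \<subseteq> {xs. set xs \<subseteq> {0..int n} \<and> length xs = k}"
  proof
    fix xs assume xs: "xs \<in> factorizations k n l"
    have "0 \<le> i \<and> i \<le> int n" if "i \<in> set xs" for i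
    proof -
      have "i dvd int n" using prod_list_dvd[OF that] xs by (simp add: factorizations_def)
      then have "i \<le> int n" using assms by (intro zdvd_imp_le) auto
      moreover have "i \<ge> int l" using xs that by (auto simp: factorizations_def)
      ultimately show ?thesis by auto
    qed
    then show "xs \<in> {xs. set xs \<subseteq> {0..int n} \<and> length xs = k}"
      using xs by (auto simp: factorizations_def)
  qed
  show "finite {xs. set xs \<subseteq> {0..int n} \<and> length xs = k}"
    by (rule finite_lists_length_eq) simp
qed

lemma prod_list_filter_partition:
  fixes xs :: "'a::comm_monoid_mult list"
  shows "prod_list xs = prod_list (filter P xs) * prod_list (filter (\<lambda>x. \<not> P x) xs)"
  by (induction xs) (auto simp: ac_simps)

lemma filter_eq_replicate:
  "filter (\<lambda>x. x = a) xs = replicate (length (filter (\<lambda>x. x = a) xs)) a"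
  by (induction xs) auto

text \<open>
  The interleavings of \<open>i\<close> copies of \<open>a\<close> with a list avoiding \<open>a\<close> form a fibre of the map
  that deletes all entries \<open>a\<close>.
\<close>

lemma in_shuffles_replicate_iff:
  assumes "a \<notin> set ys"
  shows "xs \<in> shuffles (replicate i a) ys \<longleftrightarrow>
           length (filter (\<lambda>x. x = a) xs) = i \<and> filter (\<lambda>x. x \<noteq> a) xs = ys"
proof -
  have "partition (\<lambda>x. x = a) -` {(replicate i a, ys)} = shuffles (replicate i a) ys"
    by (rule inv_image_partition) (use assms in \<open>auto simp: set_replicate_conv_if split: if_splits\<close>)
  then have "xs \<in> shuffles (replicate i a) ys \<longleftrightarrow>
      filter (\<lambda>x. x = a) xs = replicate i a \<and> filter (\<lambda>x. x \<noteq> a) xs = ys"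
    by (auto simp: o_def)
  then show ?thesis by (metis filter_eq_replicate length_replicate)
qed

lemma factorizations_count_decompose:
  assumes "l \<ge> 1" "i \<le> k" "l ^ i dvd n"
  shows "{xs \<in> factorizations k n l. length (filter (\<lambda>x. x = int l) xs) = i} =
           (\<Union>ys \<in> factorizations (k - i) (n div l ^ i) (l + 1).
              shuffles (replicate i (int l)) ys)"
    (is "?A = ?B")
proof -
  let ?eq = "\<lambda>x. x = int l"
  have prod: "prod_list xs = int l ^ i * prod_list (filter (\<lambda>x. x \<noteq> int l) xs)"
    if "length (filter ?eq xs) = i" for xs
    using prod_list_filter_partition[of xs ?eq] filter_eq_replicate[of "int l" xs] that
    by (metis prod_list_replicate)
  have len: "length xs = i + length (filter (\<lambda>x. x \<noteq> int l) xs)"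
    if "length (filter ?eq xs) = i" for xs
    using sum_length_filter_compl[of ?eq xs] that by simp
  have n: "int n = int l ^ i * int (n div l ^ i)"
    using assms(3) by (metis dvd_mult_div_cancel of_nat_mult of_nat_power)
  \<comment> \<open>Deleting the entries \<open>l\<close> turns each of the three defining conditions for \<open>k\<close>, \<open>n\<close>, \<open>l\<close>
    into the corresponding one for \<open>k - i\<close>, \<open>n / l\<^sup>i\<close>, \<open>l + 1\<close>.\<close>
  have key: "xs \<in> factorizations k n l \<longleftrightarrow>
      filter (\<lambda>x. x \<noteq> int l) xs \<in> factorizations (k - i) (n div l ^ i) (l + 1)"
    if "length (filter ?eq xs) = i" for xs
  proof -
    have "prod_list xs = int n \<longleftrightarrow>
        prod_list (filter (\<lambda>x. x \<noteq> int l) xs) = int (n div l ^ i)"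
      unfolding prod[OF that] n using assms(1) by simp
    moreover have "length xs = k \<longleftrightarrow> length (filter (\<lambda>x. x \<noteq> int l) xs) = k - i"
      using len[OF that] assms(2) by linarith
    moreover have "(\<forall>x \<in> set xs. x \<ge> int l) \<longleftrightarrow>
        (\<forall>x \<in> set (filter (\<lambda>x. x \<noteq> int l) xs). x \<ge> int (l + 1))"
      by force
    ultimately show ?thesis by (simp only: factorizations_def mem_Collect_eq)
  qed
  have "int l \<notin> set ys" if "ys \<in> factorizations (k - i) (n div l ^ i) (l + 1)" for ys
    using that by (auto simp: factorizations_def)
  then have "xs \<in> ?B \<longleftrightarrow> length (filter ?eq xs) = i \<and>
      filter (\<lambda>x. x \<noteq> int l) xs \<in> factorizations (k - i) (n div l ^ i) (l + 1)" for xs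
    by (auto simp: in_shuffles_replicate_iff)
  then show ?thesis using key by blast
qed

lemma card_factorizations_count:
  assumes "n \<ge> 1" "l \<ge> 1" "i \<le> k" "l ^ i dvd n"
  shows "card {xs \<in> factorizations k n l. length (filter (\<lambda>x. x = int l) xs) = i} =
           (k choose i) * ordered_fact (k - i) (n div l ^ i) (l + 1)"
proof -
  let ?F = "factorizations (k - i) (n div l ^ i) (l + 1)"
  have l: "int l \<notin> set ys" and len: "length ys = k - i" if "ys \<in> ?F" for ys
    using that by (auto simp: factorizations_def)
  have "n div l ^ i \<ge> 1"
    using assms by (simp add: Suc_le_eq div_greater_zero_iff dvd_imp_le)
  then have fin: "finite ?F" by (intro finite_factorizations) auto
  have card: "card (shuffles (replicate i (int l)) ys) = k choose i" if "ys \<in> ?F" for ys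
    using card_disjoint_shuffles[of "replicate i (int l)" ys] l[OF that] len[OF that] assms(3)
    by (simp add: set_replicate_conv_if)
  have "card (\<Union>ys \<in> ?F. shuffles (replicate i (int l)) ys) =
      (\<Sum>ys \<in> ?F. card (shuffles (replicate i (int l)) ys))"
    by (rule card_UN_disjoint) (use fin l in \<open>auto simp: in_shuffles_replicate_iff\<close>)
  also have "\<dots> = (k choose i) * ordered_fact (k - i) (n div l ^ i) (l + 1)"
    by (simp add: card ordered_fact_eq_card)
  finally show ?thesis using factorizations_count_decompose assms by simp
qed

section \<open>Raising the lower bound by one\<close>

theorem ordered_fact_step:
  assumes "n \<ge> 1" "l \<ge> 1"
  shows "ordered_fact k n l =
           (\<Sum>i | i \<le> k \<and> l ^ i dvd n.
              (k choose i) * ordered_fact (k - i) (n div l ^ i) (l + 1))"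
proof -
  let ?count = "\<lambda>xs. length (filter (\<lambda>x. x = int l) xs)"
  let ?I = "{i. i \<le> k \<and> l ^ i dvd n}"
  have "l ^ ?count xs dvd n" if "xs \<in> factorizations k n l" for xs
  proof -
    have "prod_list (filter (\<lambda>x. x = int l) xs) dvd prod_list xs"
      using prod_list_filter_partition[of xs "\<lambda>x. x = int l"] by simp
    moreover have "prod_list (filter (\<lambda>x. x = int l) xs) = int (l ^ ?count xs)"
      by (subst filter_eq_replicate) simp
    ultimately show ?thesis using that by (simp add: factorizations_def flip: of_nat_power)
  qed
  then have sub: "?count ` factorizations k n l \<subseteq> ?I"
    by (auto simp: factorizations_def)
  have "ordered_fact k n l = (\<Sum>xs \<in> factorizations k n l. 1)"
    by (simp add: ordered_fact_eq_card)
  also have "\<dots> = (\<Sum>i \<in> ?I. \<Sum>xs | xs \<in> factorizations k n l \<and> ?count xs = i. 1)"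
    by (rule sum.group[symmetric]) (use sub finite_factorizations[OF assms] in auto)
  also have "\<dots> = (\<Sum>i \<in> ?I. (k choose i) * ordered_fact (k - i) (n div l ^ i) (l + 1))"
    by (rule sum.cong) (use card_factorizations_count[OF assms] in auto)
  finally show ?thesis .
qed

lemma finite_nat_real_le: "finite {n::nat. 1 \<le> n \<and> real n \<le> y}"
  by (rule finite_subset[of _ "{..nat \<lfloor>y\<rfloor>}"]) (auto simp: le_nat_floor)

lemma sum_over_multiples:
  fixes g :: "nat \<Rightarrow> nat"
  assumes "d \<ge> 1"
  shows "(\<Sum>n | (1 \<le> n \<and> real n \<le> x) \<and> d dvd n. g (n div d)) =
           (\<Sum>m | 1 \<le> m \<and> real m \<le> x / real d. g m)"
proof (rule sum.reindex_bij_witness[of _ "\<lambda>m. m * d" "\<lambda>n. n div d"])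
  fix n assume "n \<in> {n. (1 \<le> n \<and> real n \<le> x) \<and> d dvd n}"
  then obtain m where "n = m * d" "1 \<le> m * d" "real m * real d \<le> x"
    by (auto simp: dvd_def mult.commute)
  then show "n div d * d = n" "n div d \<in> {m. 1 \<le> m \<and> real m \<le> x / real d}"
    using assms by (auto simp: pos_le_divide_eq)
next
  fix m assume "m \<in> {m. 1 \<le> m \<and> real m \<le> x / real d}"
  then show "m * d div d = m" "m * d \<in> {n. (1 \<le> n \<and> real n \<le> x) \<and> d dvd n}"
    using assms by (auto simp: pos_le_divide_eq)
qed simp

theorem ordered_fact_sum_step:
  assumes "l \<ge> 1"
  shows "ordered_fact_sum k x l =
           (\<Sum>i = 0..k. (k choose i) * ordered_fact_sum (k - i) (x / real l ^ i) (l + 1))"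
proof -
  let ?N = "{n::nat. 1 \<le> n \<and> real n \<le> x}"
  let ?t = "\<lambda>i n. (k choose i) * ordered_fact (k - i) (n div l ^ i) (l + 1)"
  have "ordered_fact_sum k x l = (\<Sum>n \<in> ?N. \<Sum>i | i \<in> {0..k} \<and> l ^ i dvd n. ?t i n)"
    unfolding ordered_fact_sum_def by (rule sum.cong) (use assms in \<open>auto simp: ordered_fact_step\<close>)
  also have "\<dots> = (\<Sum>i = 0..k. \<Sum>n | n \<in> ?N \<and> l ^ i dvd n. ?t i n)"
    by (rule sum.swap_restrict) (simp_all only: finite_nat_real_le finite_atLeastAtMost)
  also have "\<dots> = (\<Sum>i = 0..k. (k choose i) * ordered_fact_sum (k - i) (x / real l ^ i) (l + 1))"
  proof (rule sum.cong[OF refl])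
    fix i
    have "(\<Sum>n | n \<in> ?N \<and> l ^ i dvd n. ?t i n) =
        (k choose i) * (\<Sum>n | (1 \<le> n \<and> real n \<le> x) \<and> l ^ i dvd n.
           ordered_fact (k - i) (n div l ^ i) (l + 1))"
      by (simp add: sum_distrib_left)
    also have "\<dots> = (k choose i) * ordered_fact_sum (k - i) (x / real l ^ i) (l + 1)"
      using assms by (subst sum_over_multiples) (auto simp: ordered_fact_sum_def)
    finally show "(\<Sum>n | n \<in> ?N \<and> l ^ i dvd n. ?t i n) =
        (k choose i) * ordered_fact_sum (k - i) (x / real l ^ i) (l + 1)" .
  qed
  finally show ?thesis .
qed

section \<open>Iterating up to the root\<close>

lemma power_length_le_prod_list:
  fixes xs :: "int list"
  assumes "\<forall>i \<in> set xs. i \<ge> int l"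
  shows "int l ^ length xs \<le> prod_list xs"
  using assms
proof (induction xs)
  case (Cons a xs)
  then show ?case by (auto intro!: mult_mono)
qed simp

lemma ordered_fact_eq_0:
  assumes "n < l ^ k"
  shows "ordered_fact k n l = 0"
proof -
  have "xs \<notin> factorizations k n l" for xs
    using power_length_le_prod_list[of xs l] assms
    by (auto simp: factorizations_def simp flip: of_nat_power)
  then have "factorizations k n l = {}" by blast
  then show ?thesis by (simp add: ordered_fact_eq_card)
qed

lemma ordered_fact_sum_eq_0:
  assumes "x < real l ^ k"
  shows "ordered_fact_sum k x l = 0"
  unfolding ordered_fact_sum_def
proof (rule sum.neutral, safe)
  fix n :: nat
  assume "real n \<le> x"
  then have "real n < real (l ^ k)" using assms unfolding of_nat_power by linarith
  then show "ordered_fact k n l = 0" by (intro ordered_fact_eq_0) (simp only: of_nat_less_iff)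
qed

lemma less_power_of_floor_root_less:
  assumes "k \<ge> 1" "nat \<lfloor>root k y\<rfloor> < m"
  shows "y < real m ^ k"
proof -
  have "root k y < real m" using assms(2) by linarith
  also have "\<dots> = root k (real m ^ k)" using assms(1) by (simp add: real_root_power_cancel)
  finally show ?thesis using assms(1) by simp
qed

text \<open>
  No relation between \<open>l\<close> and \<open>M\<close> is assumed: for \<open>l > M\<close> the sum is empty and \<open>g l = 0\<close>.
\<close>

lemma telescope_vanishing:
  fixes g h :: "nat \<Rightarrow> nat"
  assumes step: "\<And>m. m \<ge> l \<Longrightarrow> g m = h m + g (m + 1)"
    and vanish: "\<And>m. m > M \<Longrightarrow> g m = 0"
  shows "g l = (\<Sum>m = l..M. h m)"
  using step
proof (induction "M + 1 - l" arbitrary: l)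
  case 0
  then have "l > M" by simp
  then show ?case using vanish[of l] by simp
next
  case (Suc d)
  have "g l = h l + g (l + 1)" by (rule Suc.prems) simp
  also have "g (l + 1) = (\<Sum>m = l + 1..M. h m)"
  proof (rule Suc.hyps(1))
    show "d = M + 1 - (l + 1)" using Suc.hyps(2) by simp
    show "g m = h m + g (m + 1)" if "m \<ge> l + 1" for m
      by (rule Suc.prems) (use that in simp)
  qed
  also have "h l + \<dots> = (\<Sum>m = l..M. h m)"
    using Suc.hyps(2) by (simp add: sum.atLeast_Suc_atMost)
  finally show ?case .
qed

theorem ordered_fact_iterated:
  assumes "n \<ge> 1" "k \<ge> 1" "l \<ge> 1"
  shows "ordered_fact k n l =
           (\<Sum>m = l..nat \<lfloor>root k (real n)\<rfloor>.
              \<Sum>i | 1 \<le> i \<and> i \<le> k \<and> m ^ i dvd n.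
                (k choose i) * ordered_fact (k - i) (n div m ^ i) (m + 1))"
proof (rule telescope_vanishing)
  fix m assume m: "m \<ge> l"
  have split: "{i. i \<le> k \<and> m ^ i dvd n} = insert 0 {i. 1 \<le> i \<and> i \<le> k \<and> m ^ i dvd n}"
    by (auto simp: Suc_le_eq)
  show "ordered_fact k n m =
      (\<Sum>i | 1 \<le> i \<and> i \<le> k \<and> m ^ i dvd n.
         (k choose i) * ordered_fact (k - i) (n div m ^ i) (m + 1)) + ordered_fact k n (m + 1)"
    using ordered_fact_step[of n m k] assms m unfolding split by simp
next
  fix m assume "nat \<lfloor>root k (real n)\<rfloor> < m"
  then have "real n < real m ^ k" by (rule less_power_of_floor_root_less[OF assms(2)])
  then have "real n < real (m ^ k)" by simp
  then show "ordered_fact k n m = 0" by (intro ordered_fact_eq_0) linarith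
qed

theorem ordered_fact_sum_iterated:
  assumes "k \<ge> 1" "l \<ge> 1"
  shows "ordered_fact_sum k x l =
           (\<Sum>m = l..nat \<lfloor>root k x\<rfloor>.
              \<Sum>i = 1..k. (k choose i) * ordered_fact_sum (k - i) (x / real m ^ i) (m + 1))"
proof (rule telescope_vanishing)
  fix m assume "m \<ge> l"
  then show "ordered_fact_sum k x m =
      (\<Sum>i = 1..k. (k choose i) * ordered_fact_sum (k - i) (x / real m ^ i) (m + 1)) +
      ordered_fact_sum k x (m + 1)"
    using ordered_fact_sum_step[of m k x] assms by (simp add: sum.atLeast_Suc_atMost)
next
  fix m assume "nat \<lfloor>root k x\<rfloor> < m"
  then show "ordered_fact_sum k x m = 0"
    using less_power_of_floor_root_less assms ordered_fact_sum_eq_0 by blast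
qed

section \<open>The identities\<close>

theorem theorem2p1:
  fixes n k l :: nat and x :: real
  assumes "n \<ge> 1" and "x \<ge> 1" and "k \<ge> 1" and "l \<ge> 1"
  shows "ordered_fact k n l =
           (\<Sum>i | 0 \<le> i \<and> i \<le> k \<and> l ^ i dvd n.
              (k choose i) * ordered_fact (k - i) (n div l ^ i) (l + 1)) \<and>
         ordered_fact_sum k x l =
           (\<Sum>i = 0..k. (k choose i) * ordered_fact_sum (k - i) (x / real l ^ i) (l + 1)) \<and>
         (k \<ge> 2 \<longrightarrow>
           ordered_fact k n l =
             (\<Sum>m = l..nat \<lfloor>root k (real n)\<rfloor>.
                \<Sum>i | 1 \<le> i \<and> i \<le> k \<and> m ^ i dvd n.
                  (k choose i) * ordered_fact (k - i) (n div m ^ i) (m + 1)) \<and>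
           ordered_fact_sum k x l =
             (\<Sum>m = l..nat \<lfloor>root k x\<rfloor>.
                \<Sum>i = 1..k.
                  (k choose i) * ordered_fact_sum (k - i) (x / real m ^ i) (m + 1)))"
proof (intro conjI impI)
  show "ordered_fact k n l =
      (\<Sum>i | 0 \<le> i \<and> i \<le> k \<and> l ^ i dvd n.
         (k choose i) * ordered_fact (k - i) (n div l ^ i) (l + 1))"
    using ordered_fact_step[of n l k] assms by simp
qed (rule ordered_fact_sum_step[OF assms(4)] ordered_fact_iterated[OF assms(1,3,4)]
       ordered_fact_sum_iterated[OF assms(3,4)])+

end
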